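(* Let $\Sigma$ be a finite alphabet with at least two symbols. There exists a nonatomic shift-invariant probability measure on $\Sigma^{\mathbb{Z}}$ defined on the Borel $\sigma$-algebra of the Besicovitch topology.
   Context: On $\Sigma^{\mathbb{Z}}$ let $d_B(x,y)=\limsup_{n\to\infty}\frac{1}{2n+1}|\{i\in[-n,n] : x_i\ne y_i\}|$; the Besicovitch topology is the topology given by this pseudometric, and its Borel $\sigma$-algebra is generated by its open sets. The shift is $\sigma(x)_i=x_{i+1}$; a measure $\mu$ is shift-invariant if $\mu(\sigma^{-1}(A))=\mu(A)$ for all measurable $A$. A measure is nonatomic if every measurable set $A$ with $\mu(A)>0$ has a measurable subset $B$ with $0<\mu(B)<\mu(A)$. *)

theory Defs
  imports "HOL-Probability.Probability"
begin

definition mismatch_density :: "(int \<Rightarrow> 'a) \<Rightarrow> (int \<Rightarrow> 'a) \<Rightarrow> nat \<Rightarrow> real" where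
  "mismatch_density x y n =
     real (card {i \<in> {- int n..int n}. x i \<noteq> y i}) / (2 * real n + 1)"

(* The limsup is taken in ereal, where limsup is total; it lies in [0,1], so that
   the conversion to real loses nothing (ereal_besicovitch_dist below). *)
definition besicovitch_dist :: "(int \<Rightarrow> 'a) \<Rightarrow> (int \<Rightarrow> 'a) \<Rightarrow> real" where
  "besicovitch_dist x y = real_of_ereal (limsup (\<lambda>n. ereal (mismatch_density x y n)))"

lemma mismatch_density_nonneg: "0 \<le> mismatch_density x y n"
  by (simp add: mismatch_density_def)

lemma mismatch_density_le_1: "mismatch_density x y n \<le> 1"
proof -
  have "card {i \<in> {- int n..int n}. x i \<noteq> y i} \<le> card {- int n..int n}"
    by (intro card_mono) auto
  also have "\<dots> = 2 * n + 1"
    by simp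
  finally have "real (card {i \<in> {- int n..int n}. x i \<noteq> y i}) \<le> real (2 * n + 1)"
    by (simp only: of_nat_le_iff)
  then show ?thesis
    by (simp add: mismatch_density_def divide_simps)
qed

lemma ereal_besicovitch_dist:
  "ereal (besicovitch_dist x y) = limsup (\<lambda>n. ereal (mismatch_density x y n))"
proof -
  let ?L = "limsup (\<lambda>n. ereal (mismatch_density x y n))"
  have "?L \<le> 1"
    by (intro Limsup_bounded always_eventually allI) (simp add: mismatch_density_le_1)
  moreover have "0 \<le> ?L"
    by (intro le_Limsup always_eventually allI) (simp_all add: mismatch_density_nonneg)
  ultimately have "\<bar>?L\<bar> \<noteq> \<infinity>"
    by auto
  then show ?thesis
    by (simp add: besicovitch_dist_def ereal_real)
qed

definition besicovitch_topology :: "(int \<Rightarrow> 'a) topology" where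
  "besicovitch_topology =
     topology (\<lambda>U. \<forall>x\<in>U. \<exists>e>0. \<forall>y. besicovitch_dist x y < e \<longrightarrow> y \<in> U)"

lemma openin_besicovitch_topology:
  "openin besicovitch_topology U \<longleftrightarrow>
     (\<forall>x\<in>U. \<exists>e>0. \<forall>y. besicovitch_dist x y < e \<longrightarrow> y \<in> U)"
proof -
  let ?P = "\<lambda>U :: (int \<Rightarrow> 'a) set. \<forall>x\<in>U. \<exists>e>0. \<forall>y. besicovitch_dist x y < e \<longrightarrow> y \<in> U"
  have "?P (S \<inter> T)" if S: "?P S" and T: "?P T" for S T
  proof
    fix x assume x: "x \<in> S \<inter> T"
    obtain d where "d > 0" "\<forall>y. besicovitch_dist x y < d \<longrightarrow> y \<in> S"
      using S x by blast
    moreover obtain e where "e > 0" "\<forall>y. besicovitch_dist x y < e \<longrightarrow> y \<in> T"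
      using T x by blast
    ultimately show "\<exists>e>0. \<forall>y. besicovitch_dist x y < e \<longrightarrow> y \<in> S \<inter> T"
      by (intro exI[of _ "min d e"]) auto
  qed
  moreover have "?P (\<Union>K)" if "\<forall>S\<in>K. ?P S" for K
    using that by (metis UnionE UnionI)
  ultimately have "istopology ?P"
    unfolding istopology_def by blast
  then show ?thesis
    by (simp add: besicovitch_topology_def topology_inverse')
qed

(* The library's borel is tied to the topology of a type class instance (for functions,
   the product topology), so the Borel sigma-algebra is built from the open sets. *)
definition besicovitch_borel :: "(int \<Rightarrow> 'a) measure" where
  "besicovitch_borel = sigma UNIV {U. openin besicovitch_topology U}"

definition shift :: "(int \<Rightarrow> 'a) \<Rightarrow> (int \<Rightarrow> 'a)" where
  "shift x = (\<lambda>i. x (i + 1))"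

definition shift_invariant :: "(int \<Rightarrow> 'a) measure \<Rightarrow> bool" where
  "shift_invariant M \<longleftrightarrow> shift \<in> measurable M M \<and>
     (\<forall>A\<in>sets M. emeasure M (shift -` A \<inter> space M) = emeasure M A)"

definition nonatomic :: "'a measure \<Rightarrow> bool" where
  "nonatomic M \<longleftrightarrow>
     (\<forall>A\<in>sets M. 0 < emeasure M A \<longrightarrow>
        (\<exists>B\<in>sets M. B \<subseteq> A \<and> 0 < emeasure M B \<and> emeasure M B < emeasure M A))"

end

theory Submission
  imports Defs "HOL-Library.Discrete_Functions" "HOL-Real_Asymp.Real_Asymp"
begin

text \<open>
  Cut the half-line of positions into the blocks \<open>[k\<^sup>2, (k+1)\<^sup>2)\<close> and let the word \<open>ramp a b t\<close> carry
  \<open>b\<close> on the initial fraction \<open>t\<close> of each block (in both directions from the origin) and \<open>a\<close> on the rest.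
  Then \<open>t \<mapsto> ramp a b t\<close> is an isometric embedding of \<open>[0,1]\<close>, and since a block contains
  only one change of letter while the block lengths tend to infinity, each of these words has
  Besicovitch distance 0 from its shift. Borel sets cannot separate points at
  distance 0, so the image of Lebesgue measure on \<open>[0,1]\<close> is trivially shift-invariant. It is
  nonatomic because the distance from \<open>ramp a b 0\<close> is a measurable function whose
  distribution is Lebesgue measure.
\<close>

subsection \<open>The Besicovitch pseudometric\<close>

lemma besicovitch_dist_le:
  assumes "\<And>n. mismatch_density x y n \<le> f n" and "f \<longlonglongrightarrow> c"
  shows "besicovitch_dist x y \<le> c"
proof -
  have "ereal (besicovitch_dist x y) \<le> limsup (\<lambda>n. ereal (f n))"
    unfolding ereal_besicovitch_dist by (intro Limsup_mono) (simp add: assms(1))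
  also have "\<dots> = ereal c"
    using assms(2) by (intro lim_imp_Limsup) auto
  finally show ?thesis
    by simp
qed

text \<open>A limsup is unaffected by an error that tends to 0. This absorbs the boundary position
  that enters the window under the shift.\<close>

lemma besicovitch_dist_le_add:
  assumes "\<And>n. mismatch_density x y n \<le> f n + mismatch_density x' y' n" and "f \<longlonglongrightarrow> 0"
  shows "besicovitch_dist x y \<le> besicovitch_dist x' y'"
proof -
  have "ereal (besicovitch_dist x y)
      \<le> limsup (\<lambda>n. ereal (f n) + ereal (mismatch_density x' y' n))"
    unfolding ereal_besicovitch_dist by (intro Limsup_mono) (simp add: assms(1))
  also have "\<dots> = ereal 0 + ereal (besicovitch_dist x' y')"
    unfolding ereal_besicovitch_dist using assms(2) by (intro ereal_limsup_lim_add) auto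
  finally show ?thesis
    by simp
qed

lemma besicovitch_dist_nonneg: "0 \<le> besicovitch_dist x y"
proof -
  have "0 \<le> limsup (\<lambda>n. ereal (mismatch_density x y n))"
    by (intro le_Limsup always_eventually allI) (simp_all add: mismatch_density_nonneg)
  then show ?thesis
    by (simp add: ereal_besicovitch_dist[symmetric])
qed

lemma besicovitch_dist_commute: "besicovitch_dist x y = besicovitch_dist y x"
  by (simp add: besicovitch_dist_def mismatch_density_def eq_commute)

lemma besicovitch_dist_triangle:
  "besicovitch_dist x z \<le> besicovitch_dist x y + besicovitch_dist y z"
proof -
  have *: "mismatch_density x z n \<le> mismatch_density x y n + mismatch_density y z n" for n
  proof -
    have "card {i \<in> {- int n..int n}. x i \<noteq> z i}
        \<le> card ({i \<in> {- int n..int n}. x i \<noteq> y i} \<union> {i \<in> {- int n..int n}. y i \<noteq> z i})"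
      by (intro card_mono) (auto intro: finite_subset[of _ "{- int n..int n}"])
    also have "\<dots> \<le> card {i \<in> {- int n..int n}. x i \<noteq> y i}
        + card {i \<in> {- int n..int n}. y i \<noteq> z i}"
      by (rule card_Un_le)
    finally show ?thesis
      unfolding mismatch_density_def add_divide_distrib[symmetric]
      by (intro divide_right_mono) linarith+
  qed
  have "ereal (besicovitch_dist x z)
      \<le> limsup (\<lambda>n. ereal (mismatch_density x y n) + ereal (mismatch_density y z n))"
    unfolding ereal_besicovitch_dist by (intro Limsup_mono) (simp add: *)
  also have "\<dots> \<le> ereal (besicovitch_dist x y) + ereal (besicovitch_dist y z)"
    unfolding ereal_besicovitch_dist by (rule ereal_limsup_add_mono)
  finally show ?thesis
    by simp
qed

text \<open>Shifting moves the window \<open>[-n, n]\<close> to \<open>[-n+1, n+1]\<close>. Only the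
  position \<open>n+1\<close> is new, and it adds at most \<open>1 / (2n+1)\<close> to the
  density.\<close>

lemma besicovitch_dist_shift_le:
  "besicovitch_dist (shift x) (shift y) \<le> besicovitch_dist x y"
proof (rule besicovitch_dist_le_add)
  fix n
  let ?S = "{i \<in> {- int n..int n}. x i \<noteq> y i}"
  have "card {i \<in> {- int n..int n}. shift x i \<noteq> shift y i}
      = card ((\<lambda>i. i + 1) ` {i \<in> {- int n..int n}. shift x i \<noteq> shift y i})"
    by (intro card_image[symmetric]) auto
  also have "\<dots> \<le> card (insert (int n + 1) ?S)"
    by (intro card_mono) (auto simp: shift_def intro: finite_subset[of _ "{- int n..int n}"])
  also have "\<dots> \<le> card ?S + 1"
    using card_insert_le_m1[of "card ?S + 1" ?S] by simp
  finally show "mismatch_density (shift x) (shift y) n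
      \<le> 1 / (2 * real n + 1) + mismatch_density x y n"
    unfolding mismatch_density_def add_divide_distrib[symmetric]
    by (intro divide_right_mono) linarith+
qed real_asymp

lemma openin_besicovitch_ball:
  "openin besicovitch_topology {y. besicovitch_dist x y < r}"
  unfolding openin_besicovitch_topology
proof safe
  fix y assume "besicovitch_dist x y < r"
  then show "\<exists>e>0. \<forall>z. besicovitch_dist y z < e \<longrightarrow> z \<in> {y. besicovitch_dist x y < r}"
    using besicovitch_dist_triangle[of x _ y]
    by (intro exI[of _ "r - besicovitch_dist x y"]) (smt (verit) mem_Collect_eq)
qed

subsection \<open>The Borel sets of the Besicovitch topology\<close>

lemma space_besicovitch_borel [simp]: "space besicovitch_borel = UNIV"
  by (simp add: besicovitch_borel_def space_measure_of_conv)

lemma sets_besicovitch_borel: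
  "sets besicovitch_borel = sigma_sets UNIV {U. openin besicovitch_topology U}"
  by (simp add: besicovitch_borel_def)

lemma measurable_besicovitch_borelI:
  assumes "\<And>U. openin besicovitch_topology U \<Longrightarrow> f -` U \<inter> space M \<in> sets M"
  shows "f \<in> measurable M besicovitch_borel"
  using assms by (intro measurable_sigma_sets[OF sets_besicovitch_borel]) auto

lemma openin_imp_sets_besicovitch_borel:
  "openin besicovitch_topology U \<Longrightarrow> U \<in> sets besicovitch_borel"
  by (simp add: sets_besicovitch_borel)

lemma shift_measurable: "shift \<in> measurable besicovitch_borel besicovitch_borel"
proof (rule measurable_besicovitch_borelI)
  fix U :: "(int \<Rightarrow> 'a) set"
  assume U: "openin besicovitch_topology U"
  have "openin besicovitch_topology (shift -` U)"
    unfolding openin_besicovitch_topology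
  proof
    fix x assume "x \<in> shift -` U"
    then obtain e where "e > 0" "\<forall>y. besicovitch_dist (shift x) y < e \<longrightarrow> y \<in> U"
      using U unfolding openin_besicovitch_topology by blast
    then show "\<exists>e>0. \<forall>y. besicovitch_dist x y < e \<longrightarrow> y \<in> shift -` U"
      using besicovitch_dist_shift_le by (metis le_less_trans vimageI)
  qed
  then show "shift -` U \<inter> space besicovitch_borel \<in> sets besicovitch_borel"
    by (simp add: openin_imp_sets_besicovitch_borel)
qed

lemma borel_measurable_besicovitch_dist:
  assumes "sets M = sets besicovitch_borel"
  shows "besicovitch_dist x \<in> borel_measurable M"
proof -
  have "space M = UNIV"
    using sets_eq_imp_space_eq[OF assms] by simp
  then show ?thesis
    by (intro borel_measurableI_less)
      (simp add: assms openin_imp_sets_besicovitch_borel openin_besicovitch_ball)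
qed

text \<open>An open set contains a small ball around each of its points, hence every point at
  distance 0 from it; complements and countable unions inherit this. It turns the distance 0 between
  a word and its shift into invariance of the measure.\<close>

lemma sets_besicovitch_borel_saturated:
  assumes "A \<in> sets besicovitch_borel" and d: "besicovitch_dist x y = 0"
  shows "x \<in> A \<longleftrightarrow> y \<in> A"
  using assms(1) unfolding sets_besicovitch_borel
proof induction
  case (Basic U)
  then show ?case
    using d besicovitch_dist_commute[of x y] unfolding mem_Collect_eq openin_besicovitch_topology
    by metis
qed auto

text \<open>The set \<open>B\<close> splitting \<open>A\<close> is the sublevel set at a median of \<open>f\<close> on \<open>A\<close>.\<close>

lemma nonatomicI_null_levels:
  fixes f :: "'a \<Rightarrow> real"
  assumes "finite_measure M" and f: "f \<in> borel_measurable M"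
    and null: "\<And>r. emeasure M {x \<in> space M. f x = r} = 0"
  shows "nonatomic M"
  unfolding nonatomic_def
proof (intro ballI impI)
  interpret finite_measure M by fact
  fix A assume A: "A \<in> sets M" "0 < emeasure M A"
  \<comment> \<open>\<open>N\<close> is the distribution of \<open>f\<close> on \<open>A\<close>,
    with total mass \<open>measure M A\<close>. Null levels of \<open>f\<close> mean that
    \<open>N\<close> has no point masses, so its cdf is continuous and the intermediate value
    theorem yields the median.\<close>
  define N where "N = distr (restrict_space M A) borel f"
  have fA: "f \<in> borel_measurable (restrict_space M A)"
    using f by (rule measurable_restrict_space1)
  have N: "measure N S = measure M {x \<in> A. f x \<in> S}" if "S \<in> sets borel" for S
    using that A(1) fA sets.sets_into_space[OF A(1)] unfolding N_def
    by (subst measure_distr) (auto simp: measure_restrict_space space_restrict_space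
        sets.Int intro!: arg_cong[where f = "measure M"])
  have "finite_measure (restrict_space M A)"
    using A(1) finite_measure_axioms by (intro finite_measure_restrict_space) (auto simp: sets.Int)
  then have "finite_measure N"
    unfolding N_def using fA by (rule finite_measure.finite_measure_distr)
  then interpret N: finite_borel_measure N
    by (intro finite_borel_measure.intro) (auto simp: finite_borel_measure_axioms_def N_def)
  have level: "measure N {r} = 0" for r
  proof -
    have "emeasure M {x \<in> A. f x \<in> {r}} \<le> emeasure M {x \<in> space M. f x = r}"
      using sets.sets_into_space[OF A(1)] f by (intro emeasure_mono) auto
    then show ?thesis
      using N[of "{r}"] by (simp add: null measure_def)
  qed
  have cont: "isCont (cdf N) r" for r
    by (simp add: N.isCont_cdf level)
  have total: "measure N (space N) = measure M A"
    using N[of UNIV] by (simp add: N.borel_UNIV)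
  have pos: "0 < measure M A"
    using A(2) by (simp add: emeasure_eq_measure)
  have "eventually (\<lambda>r. cdf N r < measure M A / 2) at_bot"
    using order_tendstoD(2)[OF N.cdf_lim_at_bot, of "measure M A / 2"] pos by simp
  then obtain l where l: "cdf N l < measure M A / 2"
    using eventually_happens'[OF trivial_limit_at_bot_linorder] by blast
  have "eventually (\<lambda>r. measure M A / 2 < cdf N r) at_top"
    using order_tendstoD(1)[OF N.cdf_lim_at_top, of "measure M A / 2"] pos total by simp
  then obtain u where u: "measure M A / 2 < cdf N u"
    using eventually_happens'[OF trivial_limit_at_top_linorder] by blast
  have "l \<le> u"
    using l u N.cdf_nondecreasing[of u l] by linarith
  then obtain r where r: "cdf N r = measure M A / 2"
    using IVT[of "cdf N" l "measure M A / 2" u] l u cont by auto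
  define B where "B = {x \<in> A. f x \<le> r}"
  have "B = A \<inter> {x \<in> space M. f x \<le> r}"
    using sets.sets_into_space[OF A(1)] by (auto simp: B_def)
  then have "B \<in> sets M"
    using A(1) f by simp
  moreover have "measure M B = measure M A / 2"
    using r N[of "{..r}"] by (simp add: cdf_def B_def)
  ultimately show "\<exists>B\<in>sets M. B \<subseteq> A \<and> 0 < emeasure M B \<and> emeasure M B < emeasure M A"
    using pos by (intro bexI[of _ B]) (auto simp: emeasure_eq_measure B_def ennreal_less_iff)
qed

subsection \<open>Words with long blocks\<close>

text \<open>The relative position of \<open>m\<close> in its block: with k =
  \<open>floor_sqrt m\<close>, the block starts at k^2 and has length (k+1)^2 - k^2 = 2k+1.\<close>

definition square_phase :: "nat \<Rightarrow> real" where
  "square_phase m = (real m - real ((floor_sqrt m)\<^sup>2)) / (2 * real (floor_sqrt m) + 1)"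

text \<open>Phases lie in [0,1), so the word is constantly \<open>a\<close> for t \<le> 0 and
  constantly \<open>b\<close> for t \<ge> 1. Thus \<open>t\<close> can range over all reals.\<close>

definition ramp :: "'a \<Rightarrow> 'a \<Rightarrow> real \<Rightarrow> int \<Rightarrow> 'a" where
  "ramp a b t i = (if square_phase (nat \<bar>i\<bar>) < t then b else a)"

lemma square_phase_nonneg: "0 \<le> square_phase m"
  by (simp add: square_phase_def del: of_nat_power)

lemma square_phase_less_1: "square_phase m < 1"
proof -
  have "real m < real ((Suc (floor_sqrt m))\<^sup>2)"
    using Suc_floor_sqrt_power2_gt[of m] by (simp only: of_nat_less_iff)
  then show ?thesis
    by (simp add: square_phase_def divide_simps power2_eq_square algebra_simps)
qed

section \<open>Counting positions by their phase\<close>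

lemma real_floor_sqrt_le: "real (floor_sqrt n) \<le> sqrt (real n)"
  by (rule real_le_rsqrt) (metis floor_sqrt_power2_le of_nat_le_iff of_nat_power)

lemma card_nat_interval_le:
  fixes u v :: real
  assumes "u \<le> v"
  shows "real (card {j :: nat. u \<le> real j \<and> real j < v}) \<le> v - u + 1"
proof -
  have "{j :: nat. u \<le> real j \<and> real j < v} = {nat \<lceil>u\<rceil>..<nat \<lceil>v\<rceil>}"
    by (auto simp: nat_le_iff ceiling_le_iff zless_nat_eq_int_zless less_ceiling_iff)
  moreover have "\<lceil>u\<rceil> \<le> \<lceil>v\<rceil>"
    using assms by (rule ceiling_mono)
  ultimately show ?thesis
    by (simp add: of_nat_diff nat_mono) linarith
qed

text \<open>Block k holds at most (t - s)(2k+1) + 1 such positions, and the lengths 2k+1 of the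
  blocks 0, ..., K add up to (K+1)^2. Rounding costs one position per block, hence only about sqrt n
  in total.\<close>

lemma card_square_phase_le:
  assumes "s \<le> t"
  shows "real (card {m. m \<le> n \<and> s \<le> square_phase m \<and> square_phase m < t})
    \<le> (t - s) * (sqrt n + 1)\<^sup>2 + sqrt n + 1"
proof -
  define K where "K = floor_sqrt n"
  define J where "J k = {j :: nat. s * (2 * real k + 1) \<le> real j \<and> real j < t * (2 * real k + 1)}"
    for k :: nat
  have fin: "finite (J k)" for k
  proof (rule finite_subset)
    show "J k \<subseteq> {..nat \<lceil>t * (2 * real k + 1)\<rceil>}"
      by (auto simp: J_def) linarith
  qed simp
  \<comment> \<open>\<open>J k\<close> holds the admissible offsets from the block start k^2. The
    last block is counted in full even if \<open>n\<close> cuts it.\<close>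
  have "{m. m \<le> n \<and> s \<le> square_phase m \<and> square_phase m < t} \<subseteq> (\<Union>k\<le>K. (\<lambda>j. k\<^sup>2 + j) ` J k)"
  proof safe
    fix m assume m: "m \<le> n" "s \<le> square_phase m" "square_phase m < t"
    let ?k = "floor_sqrt m"
    have "real (m - ?k\<^sup>2) = real m - real (?k\<^sup>2)"
      by (rule of_nat_diff) simp
    then have "m - ?k\<^sup>2 \<in> J ?k"
      using m(2,3) by (simp add: J_def square_phase_def divide_simps split: if_splits)
    then show "m \<in> (\<Union>k\<le>K. (\<lambda>j. k\<^sup>2 + j) ` J k)"
      using mono_floor_sqrt'[OF m(1)]
      by (intro UN_I[of ?k] image_eqI[of _ _ "m - ?k\<^sup>2"]) (auto simp: K_def)
  qed
  then have "card {m. m \<le> n \<and> s \<le> square_phase m \<and> square_phase m < t}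
      \<le> card (\<Union>k\<le>K. (\<lambda>j. k\<^sup>2 + j) ` J k)"
    using fin by (intro card_mono) auto
  also have "\<dots> \<le> (\<Sum>k\<le>K. card ((\<lambda>j. k\<^sup>2 + j) ` J k))"
    by (rule card_UN_le) simp
  also have "\<dots> \<le> (\<Sum>k\<le>K. card (J k))"
    by (intro sum_mono card_image_le fin)
  finally have "real (card {m. m \<le> n \<and> s \<le> square_phase m \<and> square_phase m < t})
      \<le> (\<Sum>k\<le>K. real (card (J k)))"
    by (simp only: of_nat_sum[symmetric] of_nat_le_iff)
  also have "\<dots> \<le> (\<Sum>k\<le>K. t * (2 * real k + 1) - s * (2 * real k + 1) + 1)"
    unfolding J_def using assms by (intro sum_mono card_nat_interval_le mult_right_mono) auto
  also have "\<dots> = (t - s) * (real K + 1)\<^sup>2 + real K + 1"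
    by (induction K) (simp_all add: power2_eq_square algebra_simps)
  also have "\<dots> \<le> (t - s) * (sqrt n + 1)\<^sup>2 + sqrt n + 1"
    using assms real_floor_sqrt_le[of n]
    by (intro add_mono mult_left_mono power_mono) (auto simp: K_def)
  finally show ?thesis .
qed

text \<open>Each block accounts for at most two changes: one where its phase crosses
  \<open>t\<close>, and one on entering the next block. Up to \<open>n\<close> there are only about
  sqrt n blocks.\<close>

lemma card_square_phase_changes_le:
  "real (card {m. m \<le> n \<and> (square_phase m < t) \<noteq> (square_phase (Suc m) < t)})
    \<le> 2 * (sqrt n + 1)"
proof -
  define K where "K = floor_sqrt n"
  define D where "D = {m. m \<le> n \<and> (square_phase m < t) \<noteq> (square_phase (Suc m) < t)}"
  \<comment> \<open>For \<open>t\<close> in [0,1], \<open>g k\<close> is where the phase has first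
    reached \<open>t\<close> in block k, or the start of the next block if it never does.\<close>
  define g where "g k = k\<^sup>2 + nat \<lceil>t * (2 * real k + 1)\<rceil>" for k :: nat
  have "Suc ` D \<subseteq> (\<lambda>k. (Suc k)\<^sup>2) ` {..K} \<union> g ` {..K}"
  proof safe
    fix m assume "m \<in> D" and not_g: "Suc m \<notin> g ` {..K}"
    then have m: "m \<le> n" "(square_phase m < t) \<noteq> (square_phase (Suc m) < t)"
      by (auto simp: D_def)
    let ?k = "floor_sqrt m"
    have kK: "?k \<le> K"
      unfolding K_def by (rule mono_floor_sqrt'[OF m(1)])
    have "floor_sqrt (Suc m) \<noteq> ?k"
    proof
      assume eq: "floor_sqrt (Suc m) = ?k"
      \<comment> \<open>Within one block the phase increases, so the change can only go from below
        \<open>t\<close> to at least \<open>t\<close>. The two inequalities then determine the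
        ceiling in \<open>g\<close>.\<close>
      have "real m - real (?k\<^sup>2) < t * (2 * real ?k + 1)"
           "t * (2 * real ?k + 1) \<le> real (Suc m) - real (?k\<^sup>2)"
        using m(2) unfolding square_phase_def eq by (auto simp: divide_simps split: if_splits)
      then have "\<lceil>t * (2 * real ?k + 1)\<rceil> = int (Suc m) - int (?k\<^sup>2)"
        by (intro ceiling_unique) auto
      moreover have "?k\<^sup>2 \<le> Suc m"
        using floor_sqrt_power2_le[of m] by linarith
      ultimately have "g ?k = Suc m"
        unfolding g_def by linarith
      with not_g kK show False
        by (metis atMost_iff image_eqI)
    qed
    then have "Suc m = (Suc ?k)\<^sup>2"
      using floor_sqrt_Suc[of m] floor_sqrt_power2_le[of "Suc m"] Suc_floor_sqrt_power2_gt[of m]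
      by (metis Suc_leI le_antisym)
    with kK show "Suc m \<in> (\<lambda>k. (Suc k)\<^sup>2) ` {..K}"
      by blast
  qed
  then have "card (Suc ` D) \<le> card ((\<lambda>k. (Suc k)\<^sup>2) ` {..K} \<union> g ` {..K})"
    by (intro card_mono) auto
  also have "\<dots> \<le> card ((\<lambda>k. (Suc k)\<^sup>2) ` {..K}) + card (g ` {..K})"
    by (rule card_Un_le)
  also have "\<dots> \<le> (K + 1) + (K + 1)"
    using card_image_le[of "{..K}" "\<lambda>k. (Suc k)\<^sup>2"] card_image_le[of "{..K}" g]
    by (intro add_mono) simp_all
  finally have "real (card D) \<le> real ((K + 1) + (K + 1))"
    by (simp add: card_image del: of_nat_add)
  moreover have "real K \<le> sqrt n"
    unfolding K_def by (rule real_floor_sqrt_le)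
  ultimately have "real (card D) \<le> 2 * (sqrt n + 1)"
    by simp
  then show ?thesis
    by (simp only: D_def)
qed

section \<open>Distances between ramps, and from a ramp to its shift\<close>

lemma ramp_0: "ramp a b 0 = (\<lambda>i. a)"
  by (simp add: ramp_def fun_eq_iff square_phase_nonneg leD)

lemma ramp_1: "ramp a b 1 = (\<lambda>i. b)"
  by (simp add: ramp_def fun_eq_iff square_phase_less_1)

lemma besicovitch_dist_const:
  assumes "a \<noteq> b"
  shows "besicovitch_dist (\<lambda>i. a) (\<lambda>i. b) = 1"
proof -
  have "mismatch_density (\<lambda>i. a) (\<lambda>i. b) n = 1" for n
  proof -
    have "{i \<in> {- int n..int n}. a \<noteq> b} = {- int n..int n}"
      using assms by auto
    then show ?thesis
      unfolding mismatch_density_def by simp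
  qed
  then have "limsup (\<lambda>n. ereal (mismatch_density (\<lambda>i. a) (\<lambda>i. b) n)) = 1"
    by (simp add: Limsup_const)
  then show ?thesis
    by (simp add: besicovitch_dist_def)
qed

lemma besicovitch_dist_ramp_le_ordered:
  assumes "s \<le> t"
  shows "besicovitch_dist (ramp a b s) (ramp a b t) \<le> t - s"
proof (rule besicovitch_dist_le)
  fix n
  let ?S = "{m. m \<le> n \<and> s \<le> square_phase m \<and> square_phase m < t}"
  \<comment> \<open>The two words differ at \<open>i\<close> exactly when the phase of the absolute
    value of \<open>i\<close> lies in [s, t). The two signs give a factor 2, which cancels against
    the window length 2n+1 in the limit.\<close>
  have "{i \<in> {- int n..int n}. ramp a b s i \<noteq> ramp a b t i} \<subseteq> int ` ?S \<union> (\<lambda>m. - int m) ` ?S"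
  proof
    fix i assume "i \<in> {i \<in> {- int n..int n}. ramp a b s i \<noteq> ramp a b t i}"
    then have "nat \<bar>i\<bar> \<in> ?S"
      using assms by (auto simp: ramp_def split: if_splits)
    moreover have "i = int (nat \<bar>i\<bar>) \<or> i = - int (nat \<bar>i\<bar>)"
      by linarith
    ultimately show "i \<in> int ` ?S \<union> (\<lambda>m. - int m) ` ?S"
      by blast
  qed
  then have "card {i \<in> {- int n..int n}. ramp a b s i \<noteq> ramp a b t i}
      \<le> card (int ` ?S \<union> (\<lambda>m. - int m) ` ?S)"
    by (intro card_mono) auto
  also have "\<dots> \<le> card (int ` ?S) + card ((\<lambda>m. - int m) ` ?S)"
    by (rule card_Un_le)
  also have "\<dots> \<le> card ?S + card ?S"
    by (intro add_mono card_image_le) auto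
  finally have "real (card {i \<in> {- int n..int n}. ramp a b s i \<noteq> ramp a b t i})
      \<le> 2 * real (card ?S)"
    by linarith
  also have "\<dots> \<le> 2 * ((t - s) * (sqrt n + 1)\<^sup>2 + sqrt n + 1)"
    using card_square_phase_le[OF assms, of n] by (intro mult_left_mono) simp_all
  finally show "mismatch_density (ramp a b s) (ramp a b t) n
      \<le> 2 * ((t - s) * (sqrt n + 1)\<^sup>2 + sqrt n + 1) / (2 * real n + 1)"
    unfolding mismatch_density_def by (rule divide_right_mono) simp
qed real_asymp

lemma besicovitch_dist_ramp_le:
  "besicovitch_dist (ramp a b s) (ramp a b t) \<le> \<bar>t - s\<bar>"
  using besicovitch_dist_ramp_le_ordered[of s t a b] besicovitch_dist_ramp_le_ordered[of t s a b]
  by (cases "s \<le> t") (auto simp: besicovitch_dist_commute)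

text \<open>The lower bound comes from the triangle inequality: the constant words at both ends have
  distance 1, while the two legs through \<open>ramp a b t\<close> are at most t and 1 - t, so both
  bounds are attained.\<close>

lemma besicovitch_dist_ramp_0:
  assumes "a \<noteq> b" and "t \<in> {0..1}"
  shows "besicovitch_dist (ramp a b 0) (ramp a b t) = t"
proof -
  have "1 = besicovitch_dist (ramp a b 0) (ramp a b 1)"
    unfolding ramp_0 ramp_1 using assms(1) by (simp add: besicovitch_dist_const)
  also have "\<dots> \<le> besicovitch_dist (ramp a b 0) (ramp a b t)
      + besicovitch_dist (ramp a b t) (ramp a b 1)"
    by (rule besicovitch_dist_triangle)
  finally show ?thesis
    using besicovitch_dist_ramp_le[of a b 0 t] besicovitch_dist_ramp_le[of a b t 1] assms(2)
    by auto
qed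

lemma besicovitch_dist_shift_ramp:
  "besicovitch_dist (shift (ramp a b t)) (ramp a b t) = 0"
proof -
  have "besicovitch_dist (shift (ramp a b t)) (ramp a b t) \<le> 0"
  proof (rule besicovitch_dist_le)
    fix n
    let ?D = "{m. m \<le> n \<and> (square_phase m < t) \<noteq> (square_phase (Suc m) < t)}"
    let ?E = "{i \<in> {- int n..int n}. shift (ramp a b t) i \<noteq> ramp a b t i}"
    \<comment> \<open>For negative \<open>i\<close> put m = -1 - i: the absolute values of i+1 and i
      are m and m+1. So both half-lines reduce to changes between consecutive naturals.\<close>
    have "?E \<subseteq> int ` ?D \<union> (\<lambda>m. - 1 - int m) ` ?D"
    proof
      fix i assume i: "i \<in> ?E"
      show "i \<in> int ` ?D \<union> (\<lambda>m. - 1 - int m) ` ?D"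
      proof (cases "i \<ge> 0")
        case True
        then have "nat \<bar>i + 1\<bar> = Suc (nat i)" "nat \<bar>i\<bar> = nat i"
          by linarith+
        with i have "nat i \<in> ?D"
          by (auto simp: ramp_def shift_def split: if_splits)
        with True show ?thesis
          by (intro UnI1 image_eqI[of _ _ "nat i"]) auto
      next
        case False
        then have "nat \<bar>i\<bar> = Suc (nat (- 1 - i))" "nat \<bar>i + 1\<bar> = nat (- 1 - i)"
          by linarith+
        with i have "nat (- 1 - i) \<in> ?D"
          by (auto simp: ramp_def shift_def split: if_splits)
        with False show ?thesis
          by (intro UnI2 image_eqI[of _ _ "nat (- 1 - i)"]) auto
      qed
    qed
    then have "card ?E \<le> card (int ` ?D \<union> (\<lambda>m. - 1 - int m) ` ?D)"
      by (intro card_mono) auto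
    also have "\<dots> \<le> card (int ` ?D) + card ((\<lambda>m. - 1 - int m) ` ?D)"
      by (rule card_Un_le)
    also have "\<dots> \<le> card ?D + card ?D"
      by (intro add_mono card_image_le) auto
    finally have "real (card ?E) \<le> 2 * real (card ?D)"
      by linarith
    also have "\<dots> \<le> 4 * (sqrt n + 1)"
      using card_square_phase_changes_le[of n t] by simp
    finally show "mismatch_density (shift (ramp a b t)) (ramp a b t) n
        \<le> 4 * (sqrt n + 1) / (2 * real n + 1)"
      unfolding mismatch_density_def by (rule divide_right_mono) simp
  qed real_asymp
  then show ?thesis
    using besicovitch_dist_nonneg by (rule antisym)
qed

text \<open>The map from \<open>t\<close> to the word is 1-Lipschitz, hence continuous into the
  Besicovitch topology.\<close>

lemma ramp_measurable: "ramp a b \<in> measurable borel besicovitch_borel"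
proof (rule measurable_besicovitch_borelI)
  fix U :: "(int \<Rightarrow> 'a) set"
  assume U: "openin besicovitch_topology U"
  have "open (ramp a b -` U)"
    unfolding open_dist
  proof
    fix s assume "s \<in> ramp a b -` U"
    then obtain e where "e > 0" "\<forall>y. besicovitch_dist (ramp a b s) y < e \<longrightarrow> y \<in> U"
      using U unfolding openin_besicovitch_topology by blast
    then show "\<exists>e>0. \<forall>t. dist t s < e \<longrightarrow> t \<in> ramp a b -` U"
      using besicovitch_dist_ramp_le by (metis dist_real_def le_less_trans vimageI)
  qed
  then show "ramp a b -` U \<inter> space borel \<in> sets borel"
    by simp
qed

section \<open>The image of Lebesgue measure on the unit interval\<close>

theorem theorem5:
  assumes "CARD('a :: finite) \<ge> 2"
  shows "\<exists>M :: (int \<Rightarrow> 'a) measure.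
           prob_space M \<and> sets M = sets besicovitch_borel \<and>
           shift_invariant M \<and> nonatomic M"
proof -
  obtain a b :: 'a where ab: "a \<noteq> b"
    using assms by (metis card_2_iff' ex_card UNIV_I)
  define L where "L = uniform_measure lborel {0..1::real}"
  define M where "M = distr L besicovitch_borel (ramp a b)"
  interpret L: prob_space L
    unfolding L_def by (rule prob_space_uniform_measure) auto
  have ramp: "ramp a b \<in> measurable L besicovitch_borel"
    using ramp_measurable[of a b] by (simp add: L_def cong: measurable_cong_sets)
  have sets_M: "sets M = sets besicovitch_borel" and space_M: "space M = UNIV"
    by (simp_all add: M_def)
  have emeasure_M: "emeasure M A = emeasure L (ramp a b -` A)" if "A \<in> sets besicovitch_borel" for A
    using that ramp unfolding M_def by (subst emeasure_distr) (auto simp: L_def)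
  have prob_M: "prob_space M"
    unfolding M_def using ramp by (rule L.prob_space_distr)
  have "shift_invariant M"
    unfolding shift_invariant_def
  proof
    show "shift \<in> measurable M M"
      using shift_measurable by (simp add: sets_M cong: measurable_cong_sets)
    show "\<forall>A\<in>sets M. emeasure M (shift -` A \<inter> space M) = emeasure M A"
    proof
      fix A assume "A \<in> sets M"
      then have A: "A \<in> sets besicovitch_borel"
        by (simp add: sets_M)
      have "shift -` A \<in> sets besicovitch_borel"
        using measurable_sets[OF shift_measurable A] by simp
      \<comment> \<open>Each ramp has distance 0 from its shift, so by saturation a Borel set
        contains both or neither: the preimages agree as sets, not merely up to a null set.\<close>
      moreover have "ramp a b -` (shift -` A) = ramp a b -` A"
        using sets_besicovitch_borel_saturated[OF A besicovitch_dist_shift_ramp] by auto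
      ultimately show "emeasure M (shift -` A \<inter> space M) = emeasure M A"
        by (simp add: emeasure_M A space_M)
    qed
  qed
  moreover have "nonatomic M"
  proof (rule nonatomicI_null_levels)
    show "finite_measure M"
      using prob_M by (rule prob_space.axioms)
    show f: "besicovitch_dist (ramp a b 0) \<in> borel_measurable M"
      using sets_M by (rule borel_measurable_besicovitch_dist)
    fix r
    let ?A = "{x \<in> space M. besicovitch_dist (ramp a b 0) x = r}"
    have "?A \<in> sets besicovitch_borel"
      using f unfolding sets_M[symmetric] by measurable
    moreover from this have "ramp a b -` ?A \<in> sets lborel"
      using measurable_sets[OF ramp_measurable] by fastforce
    \<comment> \<open>On [0,1] the distance from \<open>ramp a b 0\<close> recovers the parameter,
      so the level \<open>r\<close> pulls back to at most the single point \<open>r\<close>.\<close>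
    moreover have "emeasure lborel ({0..1} \<inter> ramp a b -` ?A) \<le> emeasure lborel {r}"
      using ab by (intro emeasure_mono) (auto simp: besicovitch_dist_ramp_0)
    ultimately show "emeasure M ?A = 0"
      by (simp add: emeasure_M L_def)
  qed
  ultimately show ?thesis
    using prob_M sets_M by blast
qed

end
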